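(* Let $\mu,\sigma_0,\sigma_1,\sigma_2$ be the constants of the context, arising from an environment distribution $P$ and initial configuration $\eta_0$ satisfying (A1)–(A4), and let $(V,Z)$ be the process defined in the context. If $\mu=\sigma_0^2$, then the process $V(\cdot,0)=\{V(t,0):t\ge0\}$ has covariances like those of a fractional Brownian motion (with Hurst parameter $1/4$), namely $$\mathbf E[V(s,0)V(t,0)]=\frac{\mu\sqrt{\sigma_1^2+\sigma_2^2}}{\sqrt{2\pi}}\bigl(\sqrt s+\sqrt t-\sqrt{|s-t|}\bigr),\qquad s,t\ge0,$$ but $V(\cdot,0)$ is not a Gaussian process.
   Context: Random walks in random environment: $\omega=\{\omega_x\}_{x\in\mathbb Z}\in[0,1]^{\mathbb Z}$ has law $P$, $(\theta^x\omega)_y=\omega_{x+y}$; under the quenched law $P_\omega$ the walks $X^{m,i}_\cdot$ ($m\in\mathbb Z$, $i\in\mathbb N$) are independent Markov chains on $\mathbb Z$ with $X^{m,i}_0=m$, stepping from $x$ to $x+1$ with probability $\omega_x$ and to $x-1$ with probability $1-\omega_x$. $X_n=X^{0,1}_n$. $\mathbb P(\cdot)=\int P_\omega(\cdot)P(d\omega)$; $E_P,E_\omega,\mathbb E$ are the expectations under $P,P_\omega,\mathbb P$ and $\mathrm{Var}_\omega$ the variance under $P_\omega$; $\mathbf E$ is a generic expectation. $\eta_0(x)\in\{0,1,2,\dots\}$ is the number of walks started at $x$. Assumptions. (A1) Under $P$ the $\omega_x$ are i.i.d., and there is $\kappa>0$ with $P(\omega_x\in[\kappa,1-\kappa])=1$.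 (A2) $E_P(\rho_0^2)<1$, where $\rho_x=(1-\omega_x)/\omega_x$. (A3) $\omega\mapsto P_\omega(\eta_0(0)=k)$ is measurable for each $k$; $P_\omega(\eta_0(x)=k)=P_{\theta^x\omega}(\eta_0(0)=k)$; and given $\omega$ the variables $\{\eta_0(x)\}_x$ are independent and independent of the paths of the random walks. (A4) For some $\varepsilon_0>0$, $E_P[(E_\omega\eta_0(x))^{2+\varepsilon_0}+(\mathrm{Var}_\omega\,\eta_0(x))^{2+\varepsilon_0}]<\infty$. Constants: $\mu=\mathbb E\,\eta_0(0)$, $\sigma_0^2=E_P[\mathrm{Var}_\omega(\eta_0(0))]$, $\mathrm v_P=\frac{1-E_P\rho_0}{1+E_P\rho_0}$. $T_1=\inf\{n\ge0:X_n=1\}$; $\sigma_1^2=\mathrm v_P^3E_P(\mathrm{Var}_\omega T_1)$, $\sigma_2^2=\mathrm v_P^2\,\mathrm{Var}_P(E_\omega T_1)$, with $\sigma_1>0$ and $\sigma_2>0$. Covariance function: for $\alpha>0$, $\phi_{\alpha^2}$ and $\Phi_{\alpha^2}$ are the density and distribution function of $N(0,\alpha^2)$; $\Psi_{\alpha^2}(x)=\alpha^2\phi_{\alpha^2}(x)-x\Phi_{\alpha^2}(-x)$ and $\Psi_0(x)=\lim_{\alpha\to0}\Psi_{\alpha^2}(x)=x^-=\max(-x,0)$. For $(s,q),(t,r)\in\mathbb R_+\times\mathbb R$, $$\Gamma((s,q),(t,r))=\mu\bigl(\Psi_{\sigma_1^2(s+t)}(q-r)-\Psi_{\sigma_1^2|s-t|}(q-r)\bigr)+\sigma_0^2\bigl(\Psi_{\sigma_1^2s}(-q)+\Psi_{\sigma_1^2t}(r)-\Psi_{\sigma_1^2(s+t)}(r-q)\bigr).$$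 The process $(V,Z)$: $Z(\cdot)=\sigma_2W(\cdot)$ with $W$ a standard Brownian motion; conditionally on the path $Z(\cdot)$, $V=\{V(t,r):(t,r)\in\mathbb R_+\times\mathbb R\}$ is a mean zero Gaussian process with covariance $\mathbf E[V(s,q)V(t,r)\mid Z(\cdot)]=\Gamma((s,q+Z(s)),(t,r+Z(t)))$.
   Formalization: The claim that V(·,0) is not Gaussian is made only for μ > 0: if μ = σ_0² = 0 (no particles, allowed by (A1)–(A4)), then V(t,0) = 0 almost surely, a degenerate Gaussian process; the covariance formula is stated for all μ. *)

theory Defs
  imports "HOL-Probability.Probability"
begin

section \<open>Random walks in a random environment\<close>

definition env_space :: "(int \<Rightarrow> real) measure" where
  "env_space = (\<Pi>\<^sub>M x\<in>(UNIV::int set). restrict_space borel {0..1})"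

definition shift_env :: "int \<Rightarrow> (int \<Rightarrow> real) \<Rightarrow> (int \<Rightarrow> real)" where
  "shift_env x \<omega> = (\<lambda>y. \<omega> (x + y))"

definition rho :: "(int \<Rightarrow> real) \<Rightarrow> int \<Rightarrow> real" where
  "rho \<omega> x = (1 - \<omega> x) / \<omega> x"

definition iid_elliptic_environment :: "(int \<Rightarrow> real) measure \<Rightarrow> bool" where
  "iid_elliptic_environment P \<longleftrightarrow>
     prob_space P \<and> sets P = sets env_space \<and>
     prob_space.indep_vars P (\<lambda>_. borel) (\<lambda>x \<omega>. \<omega> x) (UNIV::int set) \<and>
     (\<forall>x. distr P borel (\<lambda>\<omega>. \<omega> x) = distr P borel (\<lambda>\<omega>. \<omega> 0)) \<and>
     (\<exists>\<kappa>>0. \<forall>x. AE \<omega> in P. \<omega> x \<in> {\<kappa>..1 - \<kappa>})"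

definition step_prob :: "(int \<Rightarrow> real) \<Rightarrow> int \<Rightarrow> int \<Rightarrow> real" where
  "step_prob \<omega> x y = (if y = x + 1 then \<omega> x else if y = x - 1 then 1 - \<omega> x else 0)"

definition is_markov_chain ::
  "'b measure \<Rightarrow> (int \<Rightarrow> int \<Rightarrow> real) \<Rightarrow> int \<Rightarrow> (nat \<Rightarrow> 'b \<Rightarrow> int) \<Rightarrow> bool" where
  "is_markov_chain M p m X \<longleftrightarrow>
     (\<forall>n. X n \<in> measurable M (count_space UNIV)) \<and>
     measure M {w \<in> space M. X 0 w = m} = 1 \<and>
     (\<forall>n (path :: nat \<Rightarrow> int).
        measure M {w \<in> space M. \<forall>k\<le>Suc n. X k w = path k} =
        measure M {w \<in> space M. \<forall>k\<le>n. X k w = path k} * p (path n) (path (Suc n)))"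

text \<open>
  The quenched laws are a probability kernel \<open>Q\<close> from environments to a sample space \<open>S\<close>
  which carries both the initial configuration and all the walks; \<open>X m i n\<close> is the position at
  time \<open>n\<close> of the \<open>i\<close>-th walk started at \<open>m\<close>.
\<close>

definition quenched_walks ::
  "'b measure \<Rightarrow> ((int \<Rightarrow> real) \<Rightarrow> 'b measure) \<Rightarrow> (int \<Rightarrow> nat \<Rightarrow> nat \<Rightarrow> 'b \<Rightarrow> int) \<Rightarrow> bool" where
  "quenched_walks S Q X \<longleftrightarrow>
     Q \<in> measurable env_space (prob_algebra S) \<and>
     (\<forall>\<omega>\<in>space env_space.
        (\<forall>m i. is_markov_chain (Q \<omega>) (step_prob \<omega>) m (X m i)) \<and>
        prob_space.indep_vars (Q \<omega>) (\<lambda>_. \<Pi>\<^sub>M n\<in>(UNIV::nat set). count_space UNIV)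
          (\<lambda>(m, i) w n. X m i n w) UNIV)"

definition stationary_initial_configuration ::
  "((int \<Rightarrow> real) \<Rightarrow> 'b measure) \<Rightarrow> (int \<Rightarrow> nat \<Rightarrow> nat \<Rightarrow> 'b \<Rightarrow> int) \<Rightarrow> (int \<Rightarrow> 'b \<Rightarrow> nat) \<Rightarrow> bool" where
  "stationary_initial_configuration Q X \<eta> \<longleftrightarrow>
     (\<forall>k. (\<lambda>\<omega>. measure (Q \<omega>) {w \<in> space (Q \<omega>). \<eta> 0 w = k}) \<in> borel_measurable env_space) \<and>
     (\<forall>\<omega>\<in>space env_space. \<forall>x k.
        measure (Q \<omega>) {w \<in> space (Q \<omega>). \<eta> x w = k} =
        measure (Q (shift_env x \<omega>)) {w \<in> space (Q (shift_env x \<omega>)). \<eta> 0 w = k}) \<and>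
     (\<forall>\<omega>\<in>space env_space.
        prob_space.indep_vars (Q \<omega>) (\<lambda>_. count_space UNIV) \<eta> (UNIV::int set) \<and>
        prob_space.indep_set (Q \<omega>)
          (sets (vimage_algebra (space (Q \<omega>)) (\<lambda>w x. \<eta> x w)
             (\<Pi>\<^sub>M x\<in>(UNIV::int set). count_space UNIV)))
          (sets (vimage_algebra (space (Q \<omega>)) (\<lambda>w (m, i) n. X m i n w)
             (\<Pi>\<^sub>M j\<in>(UNIV::(int \<times> nat) set). \<Pi>\<^sub>M n\<in>(UNIV::nat set). count_space UNIV))))"

definition variance_wrt :: "'b measure \<Rightarrow> ('b \<Rightarrow> real) \<Rightarrow> real" where
  "variance_wrt M f = (\<integral>w. (f w - (\<integral>v. f v \<partial>M))\<^sup>2 \<partial>M)"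

definition quenched_mean ::
  "((int \<Rightarrow> real) \<Rightarrow> 'b measure) \<Rightarrow> (int \<Rightarrow> real) \<Rightarrow> ('b \<Rightarrow> nat) \<Rightarrow> real" where
  "quenched_mean Q \<omega> f = (\<integral>w. real (f w) \<partial>(Q \<omega>))"

definition quenched_var ::
  "((int \<Rightarrow> real) \<Rightarrow> 'b measure) \<Rightarrow> (int \<Rightarrow> real) \<Rightarrow> ('b \<Rightarrow> nat) \<Rightarrow> real" where
  "quenched_var Q \<omega> f = variance_wrt (Q \<omega>) (\<lambda>w. real (f w))"

text \<open>
  Square integrability is required explicitly, since the Bochner integral of a non-integrable
  function is \<open>0\<close> and an infinite quenched moment would otherwise go unnoticed.
\<close>

definition initial_moment_condition ::
  "(int \<Rightarrow> real) measure \<Rightarrow> ((int \<Rightarrow> real) \<Rightarrow> 'b measure) \<Rightarrow> (int \<Rightarrow> 'b \<Rightarrow> nat) \<Rightarrow> bool" where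
  "initial_moment_condition P Q \<eta> \<longleftrightarrow>
     (\<exists>\<epsilon>>0. \<forall>x.
        (AE \<omega> in P. integrable (Q \<omega>) (\<lambda>w. (real (\<eta> x w))\<^sup>2)) \<and>
        integrable P (\<lambda>\<omega>. quenched_mean Q \<omega> (\<eta> x) powr (2 + \<epsilon>)
                         + quenched_var Q \<omega> (\<eta> x) powr (2 + \<epsilon>)))"

definition averaged_law ::
  "(int \<Rightarrow> real) measure \<Rightarrow> ((int \<Rightarrow> real) \<Rightarrow> 'b measure) \<Rightarrow> 'b measure" where
  "averaged_law P Q = bind P Q"

text \<open>
  In the regime considered here the walk is transient to the right, so the value \<open>Inf {} = 0\<close>
  is only used on an event of probability zero.
\<close>

definition hitting_time_1 :: "(int \<Rightarrow> nat \<Rightarrow> nat \<Rightarrow> 'b \<Rightarrow> int) \<Rightarrow> 'b \<Rightarrow> nat" where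
  "hitting_time_1 X w = Inf {n. X 0 1 n w = 1}"

definition speed :: "(int \<Rightarrow> real) measure \<Rightarrow> real" where
  "speed P = (1 - (\<integral>\<omega>. rho \<omega> 0 \<partial>P)) / (1 + (\<integral>\<omega>. rho \<omega> 0 \<partial>P))"


section \<open>Covariance function\<close>

text \<open>The first argument of \<open>Psi\<close> is the variance \<open>\<alpha>\<^sup>2\<close>.\<close>

definition Psi :: "real \<Rightarrow> real \<Rightarrow> real" where
  "Psi v x = (if v = 0 then max (- x) 0
     else v * normal_density 0 (sqrt v) x
          - x * cdf (density lborel (\<lambda>y. ennreal (normal_density 0 (sqrt v) y))) (- x))"

text \<open>The parameters of \<open>Gamma_cov\<close> are \<open>\<mu>\<close>, \<open>\<sigma>\<^sub>0\<close> and \<open>\<sigma>\<^sub>1\<close>.\<close>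

definition Gamma_cov :: "real \<Rightarrow> real \<Rightarrow> real \<Rightarrow> real \<times> real \<Rightarrow> real \<times> real \<Rightarrow> real" where
  "Gamma_cov \<mu> \<sigma>0 \<sigma>1 = (\<lambda>(s, q) (t, r).
      \<mu> * (Psi (\<sigma>1\<^sup>2 * (s + t)) (q - r) - Psi (\<sigma>1\<^sup>2 * \<bar>s - t\<bar>) (q - r))
    + \<sigma>0\<^sup>2 * (Psi (\<sigma>1\<^sup>2 * s) (- q) + Psi (\<sigma>1\<^sup>2 * t) r - Psi (\<sigma>1\<^sup>2 * (s + t)) (r - q)))"


section \<open>Gaussian processes and Brownian motion\<close>

definition gaussian_law :: "real \<Rightarrow> real \<Rightarrow> real measure" where
  "gaussian_law m v = (if v = 0 then return borel m
     else density lborel (\<lambda>y. ennreal (normal_density m (sqrt v) y)))"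

text \<open>Degenerate Gaussian laws are allowed.\<close>

definition gaussian_process :: "'c measure \<Rightarrow> 'i set \<Rightarrow> ('i \<Rightarrow> 'c \<Rightarrow> real) \<Rightarrow> bool" where
  "gaussian_process M I Y \<longleftrightarrow>
     prob_space M \<and> (\<forall>i\<in>I. Y i \<in> borel_measurable M) \<and>
     (\<forall>J a. finite J \<longrightarrow> J \<subseteq> I \<longrightarrow>
        (\<exists>m v. v \<ge> 0 \<and> distr M borel (\<lambda>w. \<Sum>j\<in>J. a j * Y j w) = gaussian_law m v))"

definition centered_gaussian_process ::
  "'c measure \<Rightarrow> 'i set \<Rightarrow> ('i \<Rightarrow> 'c \<Rightarrow> real) \<Rightarrow> ('i \<Rightarrow> 'i \<Rightarrow> real) \<Rightarrow> bool" where
  "centered_gaussian_process M I Y C \<longleftrightarrow>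
     gaussian_process M I Y \<and>
     (\<forall>i\<in>I. (\<integral>w. Y i w \<partial>M) = 0) \<and>
     (\<forall>i\<in>I. \<forall>j\<in>I. (\<integral>w. Y i w * Y j w \<partial>M) = C i j)"

definition standard_brownian_motion :: "'c measure \<Rightarrow> (real \<Rightarrow> 'c \<Rightarrow> real) \<Rightarrow> bool" where
  "standard_brownian_motion M W \<longleftrightarrow>
     prob_space M \<and> (\<forall>t\<ge>0. W t \<in> borel_measurable M) \<and>
     (AE w in M. W 0 w = 0) \<and>
     (\<forall>s t. 0 \<le> s \<longrightarrow> s < t \<longrightarrow>
        distr M borel (\<lambda>w. W t w - W s w) = gaussian_law 0 (t - s)) \<and>
     (\<forall>(n::nat) \<tau>. 0 \<le> \<tau> 0 \<longrightarrow> (\<forall>k<n. \<tau> k \<le> \<tau> (Suc k)) \<longrightarrow>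
        prob_space.indep_vars M (\<lambda>_. borel) (\<lambda>k w. W (\<tau> (Suc k)) w - W (\<tau> k) w) {..<n}) \<and>
     (AE w in M. continuous_on {0..} (\<lambda>t. W t w))"

definition path_algebra :: "'c measure \<Rightarrow> (real \<Rightarrow> 'c \<Rightarrow> real) \<Rightarrow> 'c measure" where
  "path_algebra M Z =
     vimage_algebra (space M) (\<lambda>w. \<lambda>t\<in>{0..}. Z t w) (\<Pi>\<^sub>M t\<in>{0..}. borel)"

text \<open>
  \<open>V\<close> is conditionally on \<open>F\<close> a centered Gaussian process with (random) covariance function
  \<open>C w\<close>: a regular conditional distribution \<open>K\<close> of the whole family \<open>V\<close> given \<open>F\<close>
  is almost surely the law of such a process.
\<close>

definition conditionally_centered_gaussian ::
  "'c measure \<Rightarrow> 'c measure \<Rightarrow> 'i set \<Rightarrow> ('i \<Rightarrow> 'c \<Rightarrow> real) \<Rightarrow> ('c \<Rightarrow> 'i \<Rightarrow> 'i \<Rightarrow> real) \<Rightarrow> bool" where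
  "conditionally_centered_gaussian M F I V C \<longleftrightarrow>
     (\<forall>i\<in>I. V i \<in> borel_measurable M) \<and>
     (\<exists>K \<in> measurable F (prob_algebra (\<Pi>\<^sub>M i\<in>I. borel)).
        (\<forall>A \<in> sets (\<Pi>\<^sub>M i\<in>I. borel). AE w in M.
           real_cond_exp M F (indicator {u \<in> space M. (\<lambda>i\<in>I. V i u) \<in> A}) w = measure (K w) A) \<and>
        (AE w in M. centered_gaussian_process (K w) I (\<lambda>i y. y i) (C w)))"

end

theory Submission
  imports Defs "HOL-Real_Asymp.Real_Asymp"
begin

text \<open>
  The function \<open>\<Psi>\<^bsub>v\<^esub>(x)\<close> is the mean negative part of \<open>x + Y\<close>, where \<open>Y\<close> is centred Gaussian with variance
  \<open>v\<close> (\<open>Psi_eq_expectation\<close>). Two consequences carry the covariance formula. By symmetry of \<open>Y\<close>,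
  \<open>\<Psi>\<^bsub>v\<^esub>(- x) = \<Psi>\<^bsub>v\<^esub>(x) + x\<close>, so for \<open>\<mu> = \<sigma>\<^sub>0\<^sup>2\<close> the conditional covariance of \<open>V(s,0)\<close> and \<open>V(t,0)\<close>
  collapses to
  \<open>\<mu> (\<Psi>(- Z\<^sub>s) + \<Psi>(Z\<^sub>t) - \<Psi>(Z\<^sub>s - Z\<^sub>t) - (Z\<^sub>s - Z\<^sub>t))\<close> with variance parameters \<open>\<sigma>\<^sub>1\<^sup>2 s\<close>, \<open>\<sigma>\<^sub>1\<^sup>2 t\<close> and
  \<open>\<sigma>\<^sub>1\<^sup>2 \<bar>s - t\<bar>\<close> (\<open>Gamma_cov_equal_parameters\<close>). Since independent Gaussian variances add, averaging \<open>\<Psi>\<^bsub>a\<^esub>\<close>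
  over a centred Gaussian of variance \<open>b\<close> gives \<open>\<Psi>\<^bsub>a + b\<^esub>(0) = sqrt (a + b) / sqrt (2 \<pi>)\<close>
  (\<open>gaussian_law_expectation_Psi\<close>). Applied to the Gaussian variables \<open>Z\<^sub>s\<close>, \<open>Z\<^sub>t\<close> and \<open>Z\<^sub>s - Z\<^sub>t\<close> of variances
  \<open>\<sigma>\<^sub>2\<^sup>2 s\<close>, \<open>\<sigma>\<^sub>2\<^sup>2 t\<close> and \<open>\<sigma>\<^sub>2\<^sup>2 \<bar>s - t\<bar>\<close>, this is the stated formula.

  That moments of \<open>V\<close> may be computed by conditioning holds because the law of \<open>V\<close> is the mixture of its
  regular conditional laws given \<open>Z\<close> (\<open>conditionally_centered_gaussian_integral\<close>).

  For the last claim the single variable \<open>V(1,0)\<close> is enough. Its law is a mixture of centred Gaussian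
  laws with random variance \<open>c\<close>. If the mixture were Gaussian, it would be centred with variance
  \<open>E c\<close>, and the mean of \<open>cos V(1,0)\<close> would give \<open>E exp(- c / 2) = exp(- E c / 2)\<close>. By strict convexity \<open>c\<close>
  would then be almost surely constant
  (\<open>conditionally_centered_gaussian_constant_variance\<close>). But
  \<open>c = \<mu> (\<Psi>(- Z\<^sub>1) + \<Psi>(Z\<^sub>1)) \<ge> \<mu> \<bar>Z\<^sub>1\<bar>\<close>, and the nondegenerate Gaussian variable \<open>Z\<^sub>1\<close> is unbounded.
\<close>

section \<open>Gaussian laws\<close>

lemma sets_gaussian_law [simp, measurable_cong]: "sets (gaussian_law m v) = sets borel"
  by (simp add: gaussian_law_def)

lemma space_gaussian_law [simp]: "space (gaussian_law m v) = UNIV"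
  by (simp add: gaussian_law_def)

text \<open>
  Writing every Gaussian law as an affine image of the standard one treats the degenerate laws
  (\<open>c = 0\<close>) together with the others, and \<open>c\<close> may have either sign.
\<close>

lemma distr_std_normal_affine:
  "distr std_normal_distribution borel (\<lambda>x. m + c * x) = gaussian_law m (c\<^sup>2)"
proof -
  interpret N: real_distribution std_normal_distribution by (rule real_dist_normal_dist)
  show ?thesis
  proof (cases "c = 0")
    case True
    then show ?thesis by (simp add: gaussian_law_def N.distr_const)
  next
    case False
    have "distributed std_normal_distribution lborel (\<lambda>x. x) std_normal_density"
      by (auto simp: distributed_def intro!: distr_id2)
    from N.normal_density_affine[OF this, of c m]
    have "distributed std_normal_distribution lborel (\<lambda>x. m + c * x) (normal_density m \<bar>c\<bar>)"
      using False by simp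
    then have "distr std_normal_distribution lborel (\<lambda>x. m + c * x)
        = density lborel (\<lambda>y. ennreal (normal_density m \<bar>c\<bar> y))"
      by (rule distributed_distr_eq_density)
    moreover have "distr std_normal_distribution lborel (\<lambda>x. m + c * x)
        = distr std_normal_distribution borel (\<lambda>x. m + c * x)"
      by (rule distr_cong) auto
    ultimately show ?thesis using False by (simp add: gaussian_law_def)
  qed
qed

lemma gaussian_law_eq_distr_std_normal:
  "0 \<le> v \<Longrightarrow> gaussian_law m v = distr std_normal_distribution borel (\<lambda>x. m + sqrt v * x)"
  by (simp add: distr_std_normal_affine)

lemma prob_space_gaussian_law: "0 \<le> v \<Longrightarrow> prob_space (gaussian_law m v)"
  unfolding gaussian_law_eq_distr_std_normal
  by (intro prob_space.prob_space_distr real_distribution.axioms[OF real_dist_normal_dist]) auto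

lemma gaussian_law_moments:
  assumes "0 \<le> v"
  shows "integrable (gaussian_law m v) (\<lambda>x. x)" "(\<integral>x. x \<partial>gaussian_law m v) = m"
    and "integrable (gaussian_law m v) (\<lambda>x. x\<^sup>2)" "(\<integral>x. x\<^sup>2 \<partial>gaussian_law m v) = m\<^sup>2 + v"
proof -
  interpret N: prob_space std_normal_distribution
    using real_dist_normal_dist by (rule real_distribution.axioms)
  have i1: "integrable std_normal_distribution (\<lambda>x. x)"
    using integrable_std_normal_distribution_moment[of 1] by simp
  have i2: "integrable std_normal_distribution (\<lambda>x. x\<^sup>2)"
    by (rule integrable_std_normal_distribution_moment)
  have e1: "(\<integral>x. x \<partial>std_normal_distribution) = 0"
    using integral_std_normal_distribution_moment_odd[of 1] by simp
  have e2: "(\<integral>x. x\<^sup>2 \<partial>std_normal_distribution) = 1"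
    using std_normal_distribution_even_moments(1)[of 1] by (simp add: fact_numeral)
  have sq: "(m + sqrt v * x)\<^sup>2 = m\<^sup>2 + (2 * m * sqrt v) * x + v * x\<^sup>2" for x
    using assms by (simp add: power2_sum power_mult_distrib algebra_simps)
  have std: "measure std_normal_distribution UNIV = 1" using N.prob_space by simp
  have affine: "(\<lambda>x. m + sqrt v * x) \<in> std_normal_distribution \<rightarrow>\<^sub>M borel" by simp
  have pull: "integrable (gaussian_law m v) f = integrable std_normal_distribution (\<lambda>x. f (m + sqrt v * x))"
    "(\<integral>x. f x \<partial>gaussian_law m v) = (\<integral>x. f (m + sqrt v * x) \<partial>std_normal_distribution)"
    if "f \<in> borel_measurable borel" for f :: "real \<Rightarrow> real"
    unfolding gaussian_law_eq_distr_std_normal[OF assms] using that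
    by (simp_all only: integrable_distr_eq[OF affine] integral_distr[OF affine])
  show "integrable (gaussian_law m v) (\<lambda>x. x)"
    by (subst pull(1), measurable, intro Bochner_Integration.integrable_add integrable_mult_right i1) auto
  show "integrable (gaussian_law m v) (\<lambda>x. x\<^sup>2)"
    by (subst pull(1), measurable, unfold sq,
        intro Bochner_Integration.integrable_add integrable_mult_right i1 i2) auto
  have "(\<integral>x. m + sqrt v * x \<partial>std_normal_distribution) = m"
    by (subst Bochner_Integration.integral_add) (auto simp: std i1 e1)
  then show "(\<integral>x. x \<partial>gaussian_law m v) = m"
    by (subst pull(2)) auto
  have "(\<integral>x. m\<^sup>2 + (2 * m * sqrt v) * x + v * x\<^sup>2 \<partial>std_normal_distribution) = m\<^sup>2 + v"
    by (subst Bochner_Integration.integral_add;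
        (subst Bochner_Integration.integral_add)?) (auto simp: std i1 e1 i2 e2)
  then show "(\<integral>x. x\<^sup>2 \<partial>gaussian_law m v) = m\<^sup>2 + v"
    by (subst pull(2)) (auto simp: sq)
qed

text \<open>
  The real part of the characteristic function at \<open>1\<close>. For a centred law it determines the variance,
  and being bounded it can be averaged over random variances without moment assumptions.
\<close>

lemma gaussian_law_integral_cos:
  assumes "0 \<le> v"
  shows "(\<integral>x. cos x \<partial>gaussian_law 0 v) = exp (- v / 2)"
proof -
  interpret N: real_distribution std_normal_distribution by (rule real_dist_normal_dist)
  have "(\<integral>x. cos x \<partial>gaussian_law 0 v) = (\<integral>x. cos (sqrt v * x) \<partial>std_normal_distribution)"
    using assms by (simp add: gaussian_law_eq_distr_std_normal integral_distr)
  also have "\<dots> = (\<integral>x. Re (iexp (sqrt v * x)) \<partial>std_normal_distribution)"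
    by (simp add: Re_exp)
  also have "\<dots> = Re (char std_normal_distribution (sqrt v))"
    unfolding char_def by (rule integral_Re) (rule N.integrable_iexp, simp_all)
  also have "\<dots> = exp (- v / 2)"
    using assms by (simp add: char_std_normal_distribution)
  finally show ?thesis .
qed

lemma distr_gaussian_law_mult:
  assumes "0 \<le> v"
  shows "distr (gaussian_law 0 v) borel (\<lambda>x. c * x) = gaussian_law 0 (c\<^sup>2 * v)"
  using distr_std_normal_affine[of 0 "c * sqrt v"] assms
  by (simp add: gaussian_law_eq_distr_std_normal distr_distr comp_def power_mult_distrib mult.assoc)

text \<open>
  The degenerate cases are needed: they correspond to the times \<open>s = 0\<close>, \<open>t = 0\<close> and \<open>s = t\<close>.
\<close>

lemma gaussian_law_convolution:
  assumes "0 \<le> a" "0 \<le> b"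
  shows "gaussian_law 0 a \<star> gaussian_law 0 b = gaussian_law 0 (a + b)"
proof -
  note fin = prob_space.finite_measure[OF prob_space_gaussian_law]
  consider "a = 0" | "b = 0" | "0 < a" "0 < b" using assms by fastforce
  then show ?thesis
  proof cases
    case 1
    show ?thesis
    proof (rule measure_eqI)
      fix A :: "real set" assume "A \<in> sets (gaussian_law 0 a \<star> gaussian_law 0 b)"
      then have A [measurable]: "A \<in> sets borel" by simp
      have "(\<lambda>x. \<integral>\<^sup>+ y. indicator A (x + y) \<partial>gaussian_law 0 b) \<in> borel_measurable borel"
        using fin[OF assms(2), of 0]
        by (intro sigma_finite_measure.borel_measurable_nn_integral finite_measure.sigma_finite_measure) measurable
      then show "emeasure (gaussian_law 0 a \<star> gaussian_law 0 b) A = emeasure (gaussian_law 0 (a + b)) A"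
        using 1 assms
        by (simp add: convolution_emeasure' fin, simp add: gaussian_law_def[of 0 0] nn_integral_return)
    qed simp
  next
    case 2
    show ?thesis
    proof (rule measure_eqI)
      fix A :: "real set" assume "A \<in> sets (gaussian_law 0 a \<star> gaussian_law 0 b)"
      then have A [measurable]: "A \<in> sets borel" by simp
      show "emeasure (gaussian_law 0 a \<star> gaussian_law 0 b) A = emeasure (gaussian_law 0 (a + b)) A"
        using 2 assms
        by (simp add: convolution_emeasure' fin, simp add: gaussian_law_def[of 0 0] nn_integral_return)
    qed simp
  next
    case 3
    have "density lborel (\<lambda>y. ennreal (normal_density 0 (sqrt a) y))
          \<star> density lborel (\<lambda>y. ennreal (normal_density 0 (sqrt b) y))
        = density lborel (\<lambda>x. \<integral>\<^sup>+y. ennreal (normal_density 0 (sqrt a) (x - y)) * ennreal (normal_density 0 (sqrt b) y) \<partial>lborel)"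
      using fin[of a 0] fin[of b 0] 3
      by (intro convolution_density) (auto simp: gaussian_law_def)
    also have "\<dots> = density lborel (\<lambda>y. ennreal (normal_density 0 (sqrt (a + b)) y))"
      using conv_normal_density_zero_mean[of "sqrt a" "sqrt b"] 3
      by (auto simp: ennreal_mult'[symmetric] fun_eq_iff intro!: density_cong)
    finally show ?thesis using 3 by (simp add: gaussian_law_def)
  qed
qed

lemma gaussian_law_not_AE_bounded:
  assumes "0 < v"
  shows "\<not> (AE x in gaussian_law m v. \<bar>x\<bar> \<le> B)"
proof
  have law: "gaussian_law m v = density lborel (\<lambda>x. ennreal (normal_density m (sqrt v) x))"
    using assms by (simp add: gaussian_law_def)
  assume "AE x in gaussian_law m v. \<bar>x\<bar> \<le> B"
  then have "AE x in lborel. 0 < ennreal (normal_density m (sqrt v) x) \<longrightarrow> \<bar>x\<bar> \<le> B"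
    unfolding law by (subst (asm) AE_density) auto
  then have "AE x in lborel. \<bar>x\<bar> \<le> B"
    using assms by (simp add: normal_density_pos)
  then have "AE x in lborel. x \<notin> {\<bar>B\<bar> + 1..\<bar>B\<bar> + 2}"
    by eventually_elim auto
  (* Any interval of positive length outside [-B, B] will do. *)
  then have "{\<bar>B\<bar> + 1..\<bar>B\<bar> + 2} \<in> null_sets lborel"
    by (subst AE_iff_null_sets) auto
  then show False
    using emeasure_lborel_Icc[of "\<bar>B\<bar> + 1" "\<bar>B\<bar> + 2"] by (simp add: null_sets_def)
qed

section \<open>Mean negative parts of Gaussian variables\<close>

lemma integrable_gaussian_law_neg_part:
  assumes "0 \<le> v"
  shows "integrable (gaussian_law 0 v) (\<lambda>y. max (- (x + y)) 0)"
proof -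
  interpret G: prob_space "gaussian_law 0 v" using assms by (rule prob_space_gaussian_law)
  have "integrable (gaussian_law 0 v) (\<lambda>y. \<bar>x\<bar> + \<bar>y\<bar>)"
    using gaussian_law_moments(1)[OF assms, of 0] by simp
  then show ?thesis
    by (rule Bochner_Integration.integrable_bound) (auto simp: max_def)
qed

text \<open>
  \<open>\<Psi>\<^bsub>v\<^esub>(x)\<close> is the mean negative part of \<open>x + Y\<close> with \<open>Y\<close> centred Gaussian of variance \<open>v\<close>: on the
  event \<open>Y < - x\<close> the summand \<open>- x\<close> contributes the distribution function, and \<open>- Y\<close> contributes the
  density because \<open>- y \<phi>\<^bsub>v\<^esub>(y)\<close> is the derivative of \<open>v \<phi>\<^bsub>v\<^esub>(y)\<close>.
\<close>

lemma Psi_eq_expectation: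
  assumes "0 \<le> v"
  shows "Psi v x = (\<integral>y. max (- (x + y)) 0 \<partial>gaussian_law 0 v)"
proof (cases "v = 0")
  case True
  then show ?thesis
    by (simp add: Psi_def gaussian_law_def) (subst integral_return, auto)
next
  case False
  with assms have v: "0 < v" by simp
  define \<sigma> where "\<sigma> = sqrt v"
  have \<sigma>: "0 < \<sigma>" "\<sigma>\<^sup>2 = v" using v by (auto simp: \<sigma>_def)
  let ?D = "density lborel (\<lambda>y. ennreal (normal_density 0 \<sigma> y))"
  have law: "gaussian_law 0 v = ?D" using v by (simp add: gaussian_law_def \<sigma>_def)
  interpret D: prob_space ?D using \<sigma> by (intro prob_space_normal_density)
  have tail_integrable: "integrable lborel (\<lambda>y. indicator {..< - x} y * (- y * normal_density 0 \<sigma> y))"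
    using integrable_normal_moment_nz_1[OF \<sigma>(1), of 0]
    by (intro integrable_mult_indicator[where 'b = real, simplified]) (simp_all add: mult.commute)
  have tail: "(\<integral>y. indicator {..< - x} y * (- y * normal_density 0 \<sigma> y) \<partial>lborel)
      = v * normal_density 0 \<sigma> x"
  proof -
    have deriv: "((\<lambda>y. v * normal_density 0 \<sigma> y) has_vector_derivative (- y * normal_density 0 \<sigma> y)) (at y)" for y
      using \<sigma> unfolding normal_density_def
      by (auto intro!: derivative_eq_intros simp: has_real_derivative_iff_has_vector_derivative[symmetric] field_simps)
    have lim: "((\<lambda>y. v * normal_density 0 \<sigma> y) \<longlongrightarrow> 0) at_bot"
      using \<sigma>(1) unfolding normal_density_def by real_asymp
    have cont: "isCont (\<lambda>y. v * normal_density 0 \<sigma> y) y" for y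
      using deriv has_vector_derivative_continuous by blast
    have "(LBINT y=-\<infinity>..ereal (- x). - y * normal_density 0 \<sigma> y) = v * normal_density 0 \<sigma> (- x) - 0"
    proof (rule interval_integral_FTC_integrable)
      show "isCont (\<lambda>y. - y * normal_density 0 \<sigma> y) y" for y
        unfolding normal_density_def by (intro continuous_intros) (use \<sigma> in auto)
      show "set_integrable lborel (einterval (- \<infinity>) (ereal (- x))) (\<lambda>y. - y * normal_density 0 \<sigma> y)"
        using tail_integrable by (simp add: set_integrable_def)
      show "(((\<lambda>y. v * normal_density 0 \<sigma> y) \<circ> real_of_ereal) \<longlongrightarrow> 0) (at_right (- \<infinity>))"
        using lim by (simp add: ereal_tendsto_simps)
      show "(((\<lambda>y. v * normal_density 0 \<sigma> y) \<circ> real_of_ereal) \<longlongrightarrow> v * normal_density 0 \<sigma> (- x)) (at_left (ereal (- x)))"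
        using cont[of "- x"] by (simp add: ereal_tendsto_simps isCont_def filterlim_at_split)
    qed (use deriv in auto)
    then show ?thesis
      by (simp add: interval_lebesgue_integral_def set_lebesgue_integral_def normal_density_def)
  qed
  have "(\<integral>y. max (- (x + y)) 0 \<partial>gaussian_law 0 v)
      = (\<integral>y. (- x) * indicator {..< - x} y + indicator {..< - x} y * (- y) \<partial>?D)"
    unfolding law by (intro Bochner_Integration.integral_cong) (auto simp: indicator_def max_def)
  also have "\<dots> = (\<integral>y. (- x) * indicator {..< - x} y \<partial>?D) + (\<integral>y. indicator {..< - x} y * (- y) \<partial>?D)"
  proof (rule Bochner_Integration.integral_add)
    show "integrable ?D (\<lambda>y. (- x) * indicator {..< - x} y)"
      by (intro integrable_mult_right integrable_real_indicator) (auto simp: D.emeasure_eq_measure)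
    show "integrable ?D (\<lambda>y. indicator {..< - x} y * (- y))"
      using tail_integrable by (simp add: integrable_density normal_density_nonneg algebra_simps)
  qed
  also have "(\<integral>y. (- x) * indicator {..< - x} y \<partial>?D) = - x * measure ?D {..< - x}"
    by (subst integral_mult_right_zero) simp
  (* The boundary point is a null set. *)
  also have "measure ?D {..< - x} = cdf ?D (- x)"
    unfolding cdf_def
    by (rule measure_eq_AE) (use AE_lborel_singleton[of "- x"] in \<open>auto simp: AE_density elim!: eventually_mono\<close>)
  also have "(\<integral>y. indicator {..< - x} y * (- y) \<partial>?D) = v * normal_density 0 \<sigma> x"
    using tail by (simp add: integral_density algebra_simps)
  finally show ?thesis using v by (simp add: Psi_def \<sigma>_def)
qed

text \<open>
  The second bound is Jensen's inequality. Together they make \<open>\<Psi>\<^bsub>v\<^esub>(x) + \<Psi>\<^bsub>v\<^esub>(- x)\<close> at least \<open>\<bar>x\<bar>\<close>, hence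
  unbounded, which in the end rules out a constant conditional variance.
\<close>

lemma Psi_bounds:
  assumes "0 \<le> v"
  shows "0 \<le> Psi v x" "- x \<le> Psi v x"
proof -
  interpret G: prob_space "gaussian_law 0 v" using assms by (rule prob_space_gaussian_law)
  note int = gaussian_law_moments(1)[OF assms, of 0]
  show "0 \<le> Psi v x" unfolding Psi_eq_expectation[OF assms] by (rule integral_nonneg_AE) simp
  have "- x = (\<integral>y. - x - y \<partial>gaussian_law 0 v)"
    using int gaussian_law_moments(2)[OF assms, of 0] G.prob_space by simp
  also have "\<dots> \<le> Psi v x"
    unfolding Psi_eq_expectation[OF assms]
    by (rule integral_mono) (use int integrable_gaussian_law_neg_part[OF assms] in auto)
  finally show "- x \<le> Psi v x" .
qed

text \<open>
  By symmetry of the Gaussian law, \<open>\<Psi>\<^bsub>v\<^esub>(- x)\<close> is the mean positive part of \<open>x + Y\<close>, and positive and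
  negative part differ by \<open>x + Y\<close>.
\<close>

lemma Psi_reflect:
  assumes "0 \<le> v"
  shows "Psi v (- x) = Psi v x + x"
proof -
  interpret G: prob_space "gaussian_law 0 v" using assms by (rule prob_space_gaussian_law)
  note int = gaussian_law_moments(1)[OF assms, of 0]
  have "Psi v (- x) = (\<integral>y. max (- (- x + y)) 0 \<partial>distr (gaussian_law 0 v) borel (\<lambda>y. (- 1) * y))"
    unfolding Psi_eq_expectation[OF assms] distr_gaussian_law_mult[OF assms] by simp
  also have "\<dots> = (\<integral>y. max (x + y) 0 \<partial>gaussian_law 0 v)"
    by (subst integral_distr) (auto simp: add.commute)
  also have "\<dots> = (\<integral>y. max (- (x + y)) 0 + (x + y) \<partial>gaussian_law 0 v)"
    by (intro Bochner_Integration.integral_cong) (auto simp: max_def)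
  also have "\<dots> = Psi v x + x"
    using int integrable_gaussian_law_neg_part[OF assms, of x] gaussian_law_moments(2)[OF assms, of 0]
      G.prob_space
    by (simp add: Psi_eq_expectation[OF assms])
  finally show ?thesis .
qed

lemma borel_measurable_Psi:
  assumes "0 \<le> v"
  shows "Psi v \<in> borel_measurable borel"
proof -
  have "mono (\<lambda>x. - Psi v x)"
    unfolding Psi_eq_expectation[OF assms] using integrable_gaussian_law_neg_part[OF assms]
    by (intro monoI le_imp_neg_le integral_mono) auto
  then have "(\<lambda>x. - (- Psi v x)) \<in> borel_measurable borel"
    by (intro borel_measurable_uminus borel_measurable_mono)
  then show ?thesis by simp
qed

lemma Psi_at_zero: "0 \<le> v \<Longrightarrow> Psi v 0 = sqrt v / sqrt (2 * pi)"
  by (cases "v = 0") (auto simp: Psi_def normal_density_def real_sqrt_mult field_simps)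

text \<open>
  Averaging \<open>\<Psi>\<^bsub>a\<^esub>(X)\<close> over an independent \<open>X\<close> of variance \<open>b\<close> gives the mean negative part of the sum
  of two independent centred Gaussians. The variances add, so the result is \<open>\<Psi>\<^bsub>a + b\<^esub>(0)\<close>.
\<close>

lemma gaussian_law_expectation_Psi:
  assumes "0 \<le> a" "0 \<le> b"
  shows "integrable (gaussian_law 0 b) (Psi a)"
    and "(\<integral>x. Psi a x \<partial>gaussian_law 0 b) = sqrt (a + b) / sqrt (2 * pi)"
proof -
  note [measurable] = borel_measurable_Psi[OF assms(1)]
  let ?g = "\<lambda>u::real. ennreal (max (- u) 0)"
  note fin = prob_space.finite_measure[OF prob_space_gaussian_law]
  have nn: "(\<integral>\<^sup>+y. ?g (x + y) \<partial>gaussian_law 0 v) = ennreal (Psi v x)" if "0 \<le> v" for v x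
    unfolding Psi_eq_expectation[OF that]
    by (rule nn_integral_eq_integral) (use integrable_gaussian_law_neg_part[OF that] in auto)
  have "(\<integral>\<^sup>+x. ennreal (Psi a x) \<partial>gaussian_law 0 b) = (\<integral>\<^sup>+u. ?g u \<partial>(gaussian_law 0 b \<star> gaussian_law 0 a))"
    unfolding nn[OF assms(1), symmetric]
    by (rule nn_integral_convolution[symmetric]) (simp_all add: fin assms)
  also have "\<dots> = ennreal (sqrt (a + b) / sqrt (2 * pi))"
    using nn[of "a + b" 0] assms
    by (simp add: gaussian_law_convolution Psi_at_zero add.commute)
  finally have eq: "(\<integral>\<^sup>+x. ennreal (Psi a x) \<partial>gaussian_law 0 b) = ennreal (sqrt (a + b) / sqrt (2 * pi))" .
  show int: "integrable (gaussian_law 0 b) (Psi a)"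
    using eq assms by (intro integrableI_nonneg) (auto simp: Psi_bounds)
  show "(\<integral>x. Psi a x \<partial>gaussian_law 0 b) = sqrt (a + b) / sqrt (2 * pi)"
    using eq assms by (subst integral_eq_nn_integral) (auto simp: Psi_bounds)
qed

section \<open>Conditionally Gaussian processes\<close>

text \<open>
  Fubini for a mixture of the laws \<open>K w\<close>, with an integrable bound on the absolute first moments in
  place of boundedness of \<open>f\<close>. The proof splits \<open>f\<close> into positive and negative part in order to use
  the formula for nonnegative integrals.
\<close>

lemma integral_bind_integrable:
  fixes f :: "'b \<Rightarrow> real"
  assumes M: "space M \<noteq> {}"
    and K: "K \<in> measurable M (subprob_algebra N)"
    and f [measurable]: "f \<in> borel_measurable N"
    and bound: "AE w in M. integrable (K w) f \<and> (\<integral>y. \<bar>f y\<bar> \<partial>K w) \<le> b w"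
    and b: "integrable M b"
  shows "integrable (M \<bind> K) f" and "(\<integral>y. f y \<partial>(M \<bind> K)) = (\<integral>w. (\<integral>y. f y \<partial>K w) \<partial>M)"
proof -
  note [measurable] = measurable_compose[OF K integral_measurable_subprob_algebra]
  have sets_bind [measurable_cong]: "sets (M \<bind> K) = sets N"
    by (rule sets_bind) (use K M in \<open>auto simp: sets_kernel\<close>)
  have finite_nn: "(\<integral>\<^sup>+y. ennreal \<bar>f y\<bar> \<partial>(M \<bind> K)) < \<infinity>"
  proof -
    have "(\<integral>\<^sup>+y. ennreal \<bar>f y\<bar> \<partial>(M \<bind> K)) = (\<integral>\<^sup>+w. \<integral>\<^sup>+y. ennreal \<bar>f y\<bar> \<partial>K w \<partial>M)"
      by (rule nn_integral_bind[OF _ K]) measurable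
    also have "\<dots> \<le> (\<integral>\<^sup>+w. ennreal (b w) \<partial>M)"
    proof (rule nn_integral_mono_AE)
      show "AE w in M. (\<integral>\<^sup>+y. ennreal \<bar>f y\<bar> \<partial>K w) \<le> ennreal (b w)"
        using bound by eventually_elim (simp add: nn_integral_eq_integral ennreal_leI)
    qed
    also have "\<dots> \<le> (\<integral>\<^sup>+w. ennreal (norm (b w)) \<partial>M)"
      by (intro nn_integral_mono ennreal_leI) simp
    also have "\<dots> < \<infinity>"
      using b by (simp add: integrable_iff_bounded)
    finally show ?thesis .
  qed
  show int: "integrable (M \<bind> K) f"
    using finite_nn by (intro integrableI_bounded) auto
  have part: "integrable M (\<lambda>w. \<integral>y. g y \<partial>K w)"
      "(\<integral>y. g y \<partial>(M \<bind> K)) = (\<integral>w. (\<integral>y. g y \<partial>K w) \<partial>M)"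
    if g [measurable]: "g \<in> borel_measurable N" and nonneg: "\<And>y. 0 \<le> g y" and le: "\<And>y. g y \<le> \<bar>f y\<bar>"
    for g :: "'b \<Rightarrow> real"
  proof -
    note [measurable] = measurable_compose[OF K integral_measurable_subprob_algebra[OF g]]
    have fiber: "AE w in M. (\<integral>\<^sup>+y. ennreal (g y) \<partial>K w) = ennreal (\<integral>y. g y \<partial>K w)"
      using bound AE_space
    proof eventually_elim
      case (elim w)
      have "g \<in> borel_measurable (K w)"
        using measurable_cong_sets[OF sets_kernel[OF K elim(2)] refl] g by blast
      then have "integrable (K w) g"
        using elim(1) nonneg le by (intro Bochner_Integration.integrable_bound[of "K w" f g]) auto
      then show ?case using nonneg by (intro nn_integral_eq_integral) auto
    qed
    have eq: "(\<integral>\<^sup>+y. ennreal (g y) \<partial>(M \<bind> K)) = (\<integral>\<^sup>+w. ennreal (\<integral>y. g y \<partial>K w) \<partial>M)"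
      by (subst nn_integral_bind[OF _ K]) (use fiber in \<open>auto intro: nn_integral_cong_AE\<close>)
    have fin: "(\<integral>\<^sup>+y. ennreal (g y) \<partial>(M \<bind> K)) < \<infinity>"
      by (rule le_less_trans[OF nn_integral_mono finite_nn]) (use le in \<open>auto intro: ennreal_leI\<close>)
    show "integrable M (\<lambda>w. \<integral>y. g y \<partial>K w)"
      using eq fin nonneg by (intro integrableI_nonneg) auto
    show "(\<integral>y. g y \<partial>(M \<bind> K)) = (\<integral>w. (\<integral>y. g y \<partial>K w) \<partial>M)"
      using eq nonneg by (simp add: integral_eq_nn_integral)
  qed
  define p n where "p = (\<lambda>y. max (f y) 0)" and "n = (\<lambda>y. max (- f y) 0)"
  have split: "f = (\<lambda>y. p y - n y)" by (auto simp: p_def n_def fun_eq_iff)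
  have [measurable]: "p \<in> borel_measurable N" "n \<in> borel_measurable N" by (simp_all add: p_def n_def)
  have ints: "integrable L p" "integrable L n" if "integrable L f" for L
    using that by (auto simp: p_def n_def)
  have "(\<integral>y. f y \<partial>(M \<bind> K)) = (\<integral>y. p y \<partial>(M \<bind> K)) - (\<integral>y. n y \<partial>(M \<bind> K))"
    by (subst split) (use ints[OF int] in simp)
  also have "\<dots> = (\<integral>w. (\<integral>y. p y \<partial>K w) - (\<integral>y. n y \<partial>K w) \<partial>M)"
    using part[of p] part[of n] by (simp add: p_def n_def)
  also have "\<dots> = (\<integral>w. (\<integral>y. f y \<partial>K w) \<partial>M)"
  proof (rule integral_cong_AE)
    show "AE w in M. (\<integral>y. p y \<partial>K w) - (\<integral>y. n y \<partial>K w) = (\<integral>y. f y \<partial>K w)"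
      using bound by eventually_elim (subst split, use ints in simp)
  qed measurable
  finally show "(\<integral>y. f y \<partial>(M \<bind> K)) = (\<integral>w. (\<integral>y. f y \<partial>K w) \<partial>M)" .
qed

lemma gaussian_process_marginal:
  assumes "gaussian_process M I Y" "i \<in> I"
  obtains m v where "0 \<le> v" "distr M borel (Y i) = gaussian_law m v"
proof -
  have "\<forall>J a. finite J \<longrightarrow> J \<subseteq> I \<longrightarrow>
      (\<exists>m v. v \<ge> 0 \<and> distr M borel (\<lambda>w. \<Sum>j\<in>J. a j * Y j w) = gaussian_law m v)"
    using assms(1) unfolding gaussian_process_def by (elim conjE)
  from spec[OF spec[OF this, of "{i}"], of "\<lambda>_. 1"] show ?thesis
    using assms(2) that by auto
qed

text \<open>
  A Gaussian law has moments of all orders, so the covariance function determines the one-dimensional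
  marginals and the second moments are genuine, not default values of divergent integrals.
\<close>

lemma centered_gaussian_process_marginal:
  assumes Y: "centered_gaussian_process M I Y C" and i: "i \<in> I"
  shows "Y i \<in> borel_measurable M" "0 \<le> C i i" "distr M borel (Y i) = gaussian_law 0 (C i i)"
    and "integrable M (\<lambda>w. (Y i w)\<^sup>2)" "(\<integral>w. (Y i w)\<^sup>2 \<partial>M) = C i i"
proof -
  have gp: "gaussian_process M I Y" and mean: "(\<integral>w. Y i w \<partial>M) = 0"
    and cov: "(\<integral>w. Y i w * Y i w \<partial>M) = C i i"
    using Y i by (auto simp: centered_gaussian_process_def)
  show meas [measurable]: "Y i \<in> borel_measurable M"
    using gp i by (auto simp: gaussian_process_def)
  obtain m v where v: "0 \<le> v" and law: "distr M borel (Y i) = gaussian_law m v"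
    using gaussian_process_marginal[OF gp i] .
  have "(\<integral>x. x \<partial>distr M borel (Y i)) = (\<integral>w. Y i w \<partial>M)"
    by (rule integral_distr) auto
  then have m: "m = 0"
    unfolding law using gaussian_law_moments(2)[OF v, of m] mean by simp
  have "integrable (distr M borel (Y i)) (\<lambda>x. x\<^sup>2)"
    unfolding law by (rule gaussian_law_moments(3)[OF v])
  then show "integrable M (\<lambda>w. (Y i w)\<^sup>2)"
    by (subst (asm) integrable_distr_eq) auto
  show sq: "(\<integral>w. (Y i w)\<^sup>2 \<partial>M) = C i i"
    using cov by (simp add: power2_eq_square)
  have "(\<integral>x. x\<^sup>2 \<partial>distr M borel (Y i)) = (\<integral>w. (Y i w)\<^sup>2 \<partial>M)"
    by (rule integral_distr) auto
  then have "v = C i i"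
    unfolding law using gaussian_law_moments(4)[OF v, of m] m sq by simp
  with v law m show "0 \<le> C i i" "distr M borel (Y i) = gaussian_law 0 (C i i)" by simp_all
qed

text \<open>
  Any functional of the whole family \<open>V\<close> may be averaged in two stages: first under the Gaussian law
  with the random covariance \<open>C w\<close>, then over \<open>w\<close>. The reason is that the unconditional law of \<open>V\<close> is the
  mixture of the regular conditional laws. Quantifying over all laws \<open>L\<close> with the right Gaussian
  structure keeps the kernel out of the statement.
\<close>

lemma conditionally_centered_gaussian_integral:
  fixes f :: "('i \<Rightarrow> real) \<Rightarrow> real"
  assumes "prob_space M" and sub: "subalgebra M F"
    and V: "conditionally_centered_gaussian M F I V C"
    and f [measurable]: "f \<in> borel_measurable (\<Pi>\<^sub>M i\<in>I. borel)"
    and fiber: "\<And>w L. centered_gaussian_process L I (\<lambda>i y. y i) (C w) \<Longrightarrow>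
      integrable L f \<and> (\<integral>y. \<bar>f y\<bar> \<partial>L) \<le> b w \<and> (\<integral>y. f y \<partial>L) = g w"
    and b: "integrable M b" and g [measurable]: "g \<in> borel_measurable M"
  shows "integrable M (\<lambda>w. f (\<lambda>i\<in>I. V i w))"
    and "(\<integral>w. f (\<lambda>i\<in>I. V i w) \<partial>M) = (\<integral>w. g w \<partial>M)"
proof -
  interpret prob_space M by fact
  interpret finite_measure_subalgebra M F by unfold_locales (rule sub)
  let ?N = "\<Pi>\<^sub>M i\<in>I. (borel :: real measure)"
  let ?V = "\<lambda>w. \<lambda>i\<in>I. V i w"
  obtain K where K_F: "K \<in> measurable F (prob_algebra ?N)"
    and K_cond: "\<And>A. A \<in> sets ?N \<Longrightarrow>
      AE w in M. real_cond_exp M F (indicator {u \<in> space M. ?V u \<in> A}) w = measure (K w) A"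
    and K_gauss: "AE w in M. centered_gaussian_process (K w) I (\<lambda>i y. y i) (C w)"
    and V_meas: "\<And>i. i \<in> I \<Longrightarrow> V i \<in> borel_measurable M"
    using V unfolding conditionally_centered_gaussian_def by (elim conjE bexE) (rule that; simp)
  have V_meas' [measurable]: "?V \<in> measurable M ?N"
    by (rule measurable_restrict) (rule V_meas)
  have K_prob: "K \<in> measurable M (prob_algebra ?N)"
    using sub K_F by (rule measurable_from_subalg)
  then have K: "K \<in> measurable M (subprob_algebra ?N)"
    by (rule measurable_prob_algebraD)
  (* The conditional probabilities of an event integrate to its probability. *)
  have law: "distr M ?N ?V = M \<bind> K"
  proof (rule measure_eqI)
    show "sets (distr M ?N ?V) = sets (M \<bind> K)"
      using K not_empty by (subst sets_bind) (auto simp: sets_kernel)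
    fix A assume "A \<in> sets (distr M ?N ?V)"
    then have A [measurable]: "A \<in> sets ?N" by simp
    let ?E = "{u \<in> space M. ?V u \<in> A}"
    have E [measurable]: "?E \<in> sets M" by measurable
    have ind: "integrable M (indicator ?E :: _ \<Rightarrow> real)"
      by (rule integrable_real_indicator) (auto simp: emeasure_eq_measure)
    have K_A [measurable]: "(\<lambda>w. measure (K w) A) \<in> borel_measurable M"
      using measurable_compose[OF K measurable_measure_subprob_algebra[OF A]] .
    have prob_K: "measure (K w) A \<le> 1" "emeasure (K w) A = ennreal (measure (K w) A)" if "w \<in> space M" for w
    proof -
      have "prob_space (K w)"
        using measurable_space[OF K_prob that] by (simp add: space_prob_algebra)
      then interpret L: prob_space "K w" .
      show "measure (K w) A \<le> 1" "emeasure (K w) A = ennreal (measure (K w) A)"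
        by (simp_all add: L.emeasure_eq_measure)
    qed
    have "measure M ?E = (\<integral>w. real_cond_exp M F (indicator ?E) w \<partial>M)"
      using real_cond_exp_int(2)[OF ind] by simp
    also have "\<dots> = (\<integral>w. measure (K w) A \<partial>M)"
      using K_cond[OF A] by (intro integral_cong_AE) auto
    finally have "emeasure M ?E = ennreal (\<integral>w. measure (K w) A \<partial>M)"
      by (simp add: emeasure_eq_measure)
    also have "\<dots> = (\<integral>\<^sup>+w. ennreal (measure (K w) A) \<partial>M)"
      using prob_K(1)
      by (intro nn_integral_eq_integral[symmetric] integrable_const_bound[where B = 1] AE_I2) auto
    also have "\<dots> = (\<integral>\<^sup>+w. emeasure (K w) A \<partial>M)"
      using prob_K(2) by (intro nn_integral_cong) simp
    also have "\<dots> = emeasure (M \<bind> K) A"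
      by (rule emeasure_bind[OF not_empty K A, symmetric])
    finally show "emeasure (distr M ?N ?V) A = emeasure (M \<bind> K) A"
      by (simp add: emeasure_distr vimage_def Int_def conj_commute)
  qed
  have "AE w in M. integrable (K w) f \<and> (\<integral>y. \<bar>f y\<bar> \<partial>K w) \<le> b w"
    using K_gauss by eventually_elim (use fiber in blast)
  note bind = integral_bind_integrable[OF not_empty K f this b]
  show "integrable M (\<lambda>w. f (?V w))"
    using bind(1) unfolding law[symmetric] by (subst (asm) integrable_distr_eq) auto
  have "(\<integral>w. f (?V w) \<partial>M) = (\<integral>y. f y \<partial>(M \<bind> K))"
    unfolding law[symmetric] by (rule integral_distr[OF V_meas' f, symmetric])
  also have "\<dots> = (\<integral>w. (\<integral>y. f y \<partial>K w) \<partial>M)"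
    by (rule bind(2))
  also have "\<dots> = (\<integral>w. g w \<partial>M)"
  proof (rule integral_cong_AE)
    show "(\<lambda>w. \<integral>y. f y \<partial>K w) \<in> borel_measurable M"
      using measurable_compose[OF K integral_measurable_subprob_algebra[OF f]] .
    show "AE w in M. (\<integral>y. f y \<partial>K w) = g w"
      using K_gauss by eventually_elim (use fiber in blast)
  qed measurable
  finally show "(\<integral>w. f (?V w) \<partial>M) = (\<integral>w. g w \<partial>M)" .
qed

lemma conditionally_centered_gaussian_mean:
  assumes "prob_space M" "subalgebra M F" "conditionally_centered_gaussian M F I V C"
    and i: "i \<in> I" and var: "integrable M (\<lambda>w. C w i i)"
  shows "(\<integral>w. V i w \<partial>M) = 0"
proof -
  interpret prob_space M by fact
  have "(\<integral>w. (\<lambda>i\<in>I. V i w) i \<partial>M) = (\<integral>w. 0 \<partial>M)"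
  proof (rule conditionally_centered_gaussian_integral(2)[OF assms(1-3), where b = "\<lambda>w. 1 + C w i i"])
    show "(\<lambda>y. y i) \<in> borel_measurable (\<Pi>\<^sub>M i\<in>I. borel)"
      using i by measurable
    show "integrable M (\<lambda>w. 1 + C w i i)" using var by simp
    fix w L assume L: "centered_gaussian_process L I (\<lambda>i y. y i) (C w)"
    interpret L: prob_space L using L by (simp add: centered_gaussian_process_def gaussian_process_def)
    note marg = centered_gaussian_process_marginal[OF L i]
    note [measurable] = marg(1)
    have abs_le: "\<bar>x\<bar> \<le> 1 + x\<^sup>2" for x :: real
      using zero_le_power2[of "\<bar>x\<bar> - 1"] by (simp add: power2_diff)
    have int: "integrable L (\<lambda>y. y i)"
      by (rule Bochner_Integration.integrable_bound[of L "\<lambda>y. 1 + (y i)\<^sup>2"]) (use marg(4) abs_le in auto)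
    have "(\<integral>y. \<bar>y i\<bar> \<partial>L) \<le> (\<integral>y. 1 + (y i)\<^sup>2 \<partial>L)"
      by (rule integral_mono) (use int marg(4) abs_le in auto)
    also have "\<dots> = 1 + C w i i"
      using marg(4,5) L.prob_space by simp
    finally show "integrable L (\<lambda>y. y i) \<and> (\<integral>y. \<bar>y i\<bar> \<partial>L) \<le> 1 + C w i i \<and> (\<integral>y. y i \<partial>L) = 0"
      using int L i by (simp add: centered_gaussian_process_def)
  qed simp
  then show ?thesis using i by simp
qed

lemma conditionally_centered_gaussian_covariance:
  assumes "prob_space M" "subalgebra M F" "conditionally_centered_gaussian M F I V C"
    and i: "i \<in> I" and j: "j \<in> I"
    and var: "integrable M (\<lambda>w. C w i i)" "integrable M (\<lambda>w. C w j j)"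
    and cov: "(\<lambda>w. C w i j) \<in> borel_measurable M"
  shows "integrable M (\<lambda>w. V i w * V j w)" and "(\<integral>w. V i w * V j w \<partial>M) = (\<integral>w. C w i j \<partial>M)"
proof -
  let ?b = "\<lambda>w. (C w i i + C w j j) / 2"
  have f: "(\<lambda>y. y i * y j) \<in> borel_measurable (\<Pi>\<^sub>M i\<in>I. (borel :: real measure))"
    using i j by measurable
  have b: "integrable M ?b" using var by simp
  have fiber: "integrable L (\<lambda>y. y i * y j) \<and> (\<integral>y. \<bar>y i * y j\<bar> \<partial>L) \<le> ?b w \<and> (\<integral>y. y i * y j \<partial>L) = C w i j"
    if L: "centered_gaussian_process L I (\<lambda>i y. y i) (C w)" for w L
  proof -
    note mi = centered_gaussian_process_marginal[OF L i]
    note mj = centered_gaussian_process_marginal[OF L j]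
    note [measurable] = mi(1) mj(1)
    (* This turns the two variances into an integrable bound for the mixed moment. *)
    have am_gm: "\<bar>x * y\<bar> \<le> (x\<^sup>2 + y\<^sup>2) / 2" for x y :: real
      using zero_le_power2[of "\<bar>x\<bar> - \<bar>y\<bar>"] by (simp add: power2_diff abs_mult)
    have int: "integrable L (\<lambda>y. y i * y j)"
      by (rule Bochner_Integration.integrable_bound[of L "\<lambda>y. ((y i)\<^sup>2 + (y j)\<^sup>2) / 2"])
         (use mi(4) mj(4) am_gm in auto)
    have "(\<integral>y. \<bar>y i * y j\<bar> \<partial>L) \<le> (\<integral>y. ((y i)\<^sup>2 + (y j)\<^sup>2) / 2 \<partial>L)"
      by (rule integral_mono) (use int mi(4) mj(4) am_gm in auto)
    also have "\<dots> = ?b w"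
      using mi(4,5) mj(4,5) by simp
    finally show ?thesis
      using int L i j by (simp add: centered_gaussian_process_def)
  qed
  note * = conditionally_centered_gaussian_integral[OF assms(1-3) f fiber b cov]
  show "integrable M (\<lambda>w. V i w * V j w)" "(\<integral>w. V i w * V j w \<partial>M) = (\<integral>w. C w i j \<partial>M)"
    using * i j by simp_all
qed

lemma conditionally_centered_gaussian_cos:
  assumes "prob_space M" "subalgebra M F" "conditionally_centered_gaussian M F I V C"
    and i: "i \<in> I" and var: "(\<lambda>w. C w i i) \<in> borel_measurable M"
  shows "(\<integral>w. cos (V i w) \<partial>M) = (\<integral>w. exp (- C w i i / 2) \<partial>M)"
proof -
  interpret prob_space M by fact
  have "(\<integral>w. cos ((\<lambda>i\<in>I. V i w) i) \<partial>M) = (\<integral>w. exp (- C w i i / 2) \<partial>M)"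
  proof (rule conditionally_centered_gaussian_integral(2)[OF assms(1-3), where b = "\<lambda>_. 1"])
    show "(\<lambda>y. cos (y i)) \<in> borel_measurable (\<Pi>\<^sub>M i\<in>I. (borel :: real measure))"
      by (rule measurable_compose[OF measurable_component_singleton[OF i]
          borel_measurable_continuous_onI[OF continuous_on_cos[OF continuous_on_id]]])
    show "(\<lambda>w. exp (- C w i i / 2)) \<in> borel_measurable M" using var by measurable
    fix w L assume L: "centered_gaussian_process L I (\<lambda>i y. y i) (C w)"
    interpret L: prob_space L using L by (simp add: centered_gaussian_process_def gaussian_process_def)
    note marg = centered_gaussian_process_marginal[OF L i]
    note [measurable] = marg(1)
    have int: "integrable L (\<lambda>y. cos (y i))"
      by (rule L.integrable_const_bound[where B = 1]) auto
    have "(\<integral>y. \<bar>cos (y i)\<bar> \<partial>L) \<le> (\<integral>y. 1 \<partial>L)"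
      by (rule integral_mono) (use int in auto)
    moreover have "(\<integral>y. cos (y i) \<partial>L) = (\<integral>x. cos x \<partial>distr L borel (\<lambda>y. y i))"
      by (rule integral_distr[symmetric]) auto
    ultimately show "integrable L (\<lambda>y. cos (y i)) \<and> (\<integral>y. \<bar>cos (y i)\<bar> \<partial>L) \<le> 1
        \<and> (\<integral>y. cos (y i) \<partial>L) = exp (- C w i i / 2)"
      using int L.prob_space by (simp add: marg(3) gaussian_law_integral_cos[OF marg(2)])
  qed simp
  then show ?thesis using i by simp
qed

text \<open>
  The equality case of Jensen's inequality for the strictly convex function \<open>exp (- x / 2)\<close>: the
  excess of this function over its tangent at the mean of \<open>c\<close> is nonnegative and has integral zero.
\<close>

lemma AE_eq_expectation_if_exp_Jensen_eq:
  fixes c :: "'a \<Rightarrow> real"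
  assumes "prob_space M" and c: "integrable M c" and nonneg: "AE w in M. 0 \<le> c w"
    and eq: "(\<integral>w. exp (- c w / 2) \<partial>M) = exp (- (\<integral>w. c w \<partial>M) / 2)"
  shows "AE w in M. c w = (\<integral>w. c w \<partial>M)"
proof -
  interpret prob_space M by fact
  define e where "e = (\<integral>w. c w \<partial>M)"
  have [measurable]: "c \<in> borel_measurable M" using c by simp
  have int: "integrable M (\<lambda>w. exp (- c w / 2))"
    using nonneg by (intro integrable_const_bound[where B = 1]) auto
  (* h is the excess of exp ((e - c) / 2) over its tangent 1 + (e - c) / 2 at 0, in the form that is
     visibly integrable. *)
  define h where "h = (\<lambda>w. exp (e / 2) * exp (- c w / 2) - 1 + (c w - e) / 2)"
  have h: "h w = exp ((e - c w) / 2) - (1 + (e - c w) / 2)" for w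
    by (simp add: h_def mult_exp_exp diff_divide_distrib)
  have "0 \<le> h w" for w
    unfolding h using exp_ge_add_one_self[of "(e - c w) / 2"] by simp
  moreover have "integrable M h"
    unfolding h_def using int c by simp
  moreover have "(\<integral>w. h w \<partial>M) = 0"
    unfolding h_def using int c eq
    by (simp add: prob_space flip: e_def) (simp add: mult_exp_exp)
  ultimately have "AE w in M. h w = 0"
    using integral_nonneg_eq_0_iff_AE[of M h] by simp
  then show ?thesis
  proof eventually_elim
    case (elim w)
    then have "ln (exp ((e - c w) / 2)) = exp ((e - c w) / 2) - 1"
      unfolding h ln_exp by linarith
    then have "exp ((e - c w) / 2) = 1"
      by (rule ln_eq_minus_one[OF exp_gt_zero])
    then show ?case by (simp add: e_def)
  qed
qed

section \<open>Brownian motion\<close>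

lemma subalgebra_path_algebra:
  assumes "\<And>t. 0 \<le> t \<Longrightarrow> Z t \<in> borel_measurable M"
  shows "subalgebra M (path_algebra M Z)"
proof -
  have Z: "(\<lambda>w. \<lambda>t\<in>{0..}. Z t w) \<in> measurable M (\<Pi>\<^sub>M t\<in>{0..}. borel)"
    by (rule measurable_restrict) (use assms in auto)
  have "(\<lambda>w. \<lambda>t\<in>{0..}. Z t w) -` A \<inter> space M \<in> sets M"
    if "A \<in> sets (\<Pi>\<^sub>M t\<in>{0..}. borel)" for A
    using measurable_sets[OF Z that] .
  then show ?thesis
    using measurable_space[OF Z]
    by (auto simp: subalgebra_def path_algebra_def sets_vimage_algebra2)
qed

lemma brownian_increment_law:
  assumes W: "standard_brownian_motion M W" and "0 \<le> s" "0 \<le> t"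
  shows "distr M borel (\<lambda>w. c * (W s w - W t w)) = gaussian_law 0 (c\<^sup>2 * \<bar>s - t\<bar>)"
proof -
  interpret prob_space M using W by (simp add: standard_brownian_motion_def)
  have meas: "W u \<in> borel_measurable M" if "0 \<le> u" for u
    using W that by (simp add: standard_brownian_motion_def)
  have incr: "distr M borel (\<lambda>w. d * (W u w - W r w)) = gaussian_law 0 (d\<^sup>2 * (u - r))"
    if "0 \<le> r" "r < u" for d r u
  proof -
    note [measurable] = meas[of r] meas[of u]
    have "distr M borel (\<lambda>w. d * (W u w - W r w))
        = distr (distr M borel (\<lambda>w. W u w - W r w)) borel (\<lambda>x. d * x)"
      using that by (subst distr_distr) (auto simp: comp_def)
    also have "\<dots> = gaussian_law 0 (d\<^sup>2 * (u - r))"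
      using W that distr_gaussian_law_mult[of "u - r" d] by (simp add: standard_brownian_motion_def)
    finally show ?thesis .
  qed
  consider "s = t" | "t < s" | "s < t" by linarith
  then show ?thesis
  proof cases
    case 1
    then show ?thesis by (simp add: gaussian_law_def distr_const)
  next
    case 2
    then show ?thesis using incr[of t s c] assms by simp
  next
    case 3
    (* The sign of c absorbs the reversal of the increment. *)
    then show ?thesis using incr[of s t "- c"] assms by (simp add: algebra_simps)
  qed
qed

lemma brownian_marginal_law:
  assumes W: "standard_brownian_motion M W" and t: "0 \<le> t"
  shows "distr M borel (\<lambda>w. c * W t w) = gaussian_law 0 (c\<^sup>2 * t)"
proof -
  have [measurable]: "W t \<in> borel_measurable M" "W 0 \<in> borel_measurable M"
    using W t by (simp_all add: standard_brownian_motion_def)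
  have "distr M borel (\<lambda>w. c * W t w) = distr M borel (\<lambda>w. c * (W t w - W 0 w))"
  proof (rule distr_cong_AE)
    show "AE w in M. c * W t w = c * (W t w - W 0 w)"
      using W by (auto simp: standard_brownian_motion_def elim: eventually_mono)
  qed auto
  then show ?thesis using brownian_increment_law[OF W t, of 0 c] t by simp
qed

lemma gaussian_variable_expectation:
  assumes X [measurable]: "X \<in> borel_measurable M" and law: "distr M borel X = gaussian_law 0 b"
    and "0 \<le> b"
  shows "integrable M X" "(\<integral>w. X w \<partial>M) = 0"
    and "0 \<le> a \<Longrightarrow> integrable M (\<lambda>w. Psi a (X w))"
    and "0 \<le> a \<Longrightarrow> (\<integral>w. Psi a (X w) \<partial>M) = sqrt (a + b) / sqrt (2 * pi)"
proof -
  note pull = integrable_distr_eq[OF X, unfolded law] integral_distr[OF X, unfolded law]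
  show "integrable M X"
    using gaussian_law_moments(1)[OF \<open>0 \<le> b\<close>, of 0] by (subst (asm) pull(1)) auto
  show "(\<integral>w. X w \<partial>M) = 0"
    using gaussian_law_moments(2)[OF \<open>0 \<le> b\<close>, of 0] by (subst (asm) pull(2)) auto
  assume a: "0 \<le> a"
  show "integrable M (\<lambda>w. Psi a (X w))"
    using gaussian_law_expectation_Psi(1)[OF a \<open>0 \<le> b\<close>]
    by (subst (asm) pull(1)) (rule borel_measurable_Psi[OF a])
  show "(\<integral>w. Psi a (X w) \<partial>M) = sqrt (a + b) / sqrt (2 * pi)"
    using gaussian_law_expectation_Psi(2)[OF a \<open>0 \<le> b\<close>]
    by (subst (asm) pull(2)) (rule borel_measurable_Psi[OF a])
qed

section \<open>Covariances and marginal laws at the origin\<close>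

text \<open>
  If \<open>\<mu> = \<sigma>\<^sub>0\<^sup>2\<close>, the two terms of variance \<open>\<sigma>\<^sub>1\<^sup>2(s + t)\<close> carry opposite signs and reflected arguments, so
  by the reflection identity only the linear term \<open>- (p - q)\<close> of them survives.
\<close>

lemma Gamma_cov_equal_parameters:
  assumes "\<mu> = \<sigma>0\<^sup>2" "0 \<le> s" "0 \<le> t"
  shows "Gamma_cov \<mu> \<sigma>0 \<sigma>1 (s, p) (t, q)
    = \<mu> * (Psi (\<sigma>1\<^sup>2 * s) (- p) + Psi (\<sigma>1\<^sup>2 * t) q - Psi (\<sigma>1\<^sup>2 * \<bar>s - t\<bar>) (p - q) - (p - q))"
proof -
  have "Psi (\<sigma>1\<^sup>2 * (s + t)) (q - p) = Psi (\<sigma>1\<^sup>2 * (s + t)) (p - q) + (p - q)"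
    using Psi_reflect[of "\<sigma>1\<^sup>2 * (s + t)" "p - q"] assms by simp
  then show ?thesis
    unfolding Gamma_cov_def prod.case assms(1)[symmetric] \<open>Psi _ (q - p) = _\<close>
    by (simp only: algebra_simps)
qed

text \<open>
  Each of the three \<open>\<Psi>\<close> terms has Gaussian variance \<open>\<sigma>\<^sub>1\<^sup>2 u\<close> inside and is evaluated at a centred
  Gaussian of variance \<open>\<sigma>\<^sub>2\<^sup>2 u\<close>, with \<open>u\<close> equal to \<open>s\<close>, \<open>t\<close> and \<open>\<bar>s - t\<bar>\<close>, and so contributes
  \<open>sqrt ((\<sigma>\<^sub>1\<^sup>2 + \<sigma>\<^sub>2\<^sup>2) u / (2 \<pi>))\<close>; the linear term has mean zero.
\<close>

lemma Gamma_cov_brownian_expectation: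
  assumes W: "standard_brownian_motion M W" and Z: "\<And>t w. 0 \<le> t \<Longrightarrow> Z t w = \<sigma>2 * W t w"
    and eq: "\<mu> = \<sigma>0\<^sup>2" and s: "0 \<le> s" and t: "0 \<le> t"
  shows "integrable M (\<lambda>w. Gamma_cov \<mu> \<sigma>0 \<sigma>1 (s, Z s w) (t, Z t w))"
    and "(\<integral>w. Gamma_cov \<mu> \<sigma>0 \<sigma>1 (s, Z s w) (t, Z t w) \<partial>M)
      = \<mu> * sqrt (\<sigma>1\<^sup>2 + \<sigma>2\<^sup>2) / sqrt (2 * pi) * (sqrt s + sqrt t - sqrt \<bar>s - t\<bar>)"
proof -
  have [measurable]: "W s \<in> borel_measurable M" "W t \<in> borel_measurable M"
    using W s t by (simp_all add: standard_brownian_motion_def)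
  have Gamma: "Gamma_cov \<mu> \<sigma>0 \<sigma>1 (s, Z s w) (t, Z t w)
    = \<mu> * (Psi (\<sigma>1\<^sup>2 * s) (- \<sigma>2 * W s w) + Psi (\<sigma>1\<^sup>2 * t) (\<sigma>2 * W t w)
        - Psi (\<sigma>1\<^sup>2 * \<bar>s - t\<bar>) (\<sigma>2 * (W s w - W t w)) - \<sigma>2 * (W s w - W t w))" for w
    using Gamma_cov_equal_parameters[OF eq s t, of \<sigma>1 "Z s w" "Z t w"]
    by (simp add: Z s t right_diff_distrib)
  have S: "integrable M (\<lambda>w. Psi (\<sigma>1\<^sup>2 * s) (- \<sigma>2 * W s w))"
    "(\<integral>w. Psi (\<sigma>1\<^sup>2 * s) (- \<sigma>2 * W s w) \<partial>M) = sqrt (\<sigma>1\<^sup>2 * s + (- \<sigma>2)\<^sup>2 * s) / sqrt (2 * pi)"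
    by (rule gaussian_variable_expectation[OF _ brownian_marginal_law[OF W s]]; use s in simp)+
  have T: "integrable M (\<lambda>w. Psi (\<sigma>1\<^sup>2 * t) (\<sigma>2 * W t w))"
    "(\<integral>w. Psi (\<sigma>1\<^sup>2 * t) (\<sigma>2 * W t w) \<partial>M) = sqrt (\<sigma>1\<^sup>2 * t + \<sigma>2\<^sup>2 * t) / sqrt (2 * pi)"
    by (rule gaussian_variable_expectation[OF _ brownian_marginal_law[OF W t]]; use t in simp)+
  have D: "integrable M (\<lambda>w. Psi (\<sigma>1\<^sup>2 * \<bar>s - t\<bar>) (\<sigma>2 * (W s w - W t w)))"
    "(\<integral>w. Psi (\<sigma>1\<^sup>2 * \<bar>s - t\<bar>) (\<sigma>2 * (W s w - W t w)) \<partial>M)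
      = sqrt (\<sigma>1\<^sup>2 * \<bar>s - t\<bar> + \<sigma>2\<^sup>2 * \<bar>s - t\<bar>) / sqrt (2 * pi)"
    "integrable M (\<lambda>w. \<sigma>2 * (W s w - W t w))" "(\<integral>w. \<sigma>2 * (W s w - W t w) \<partial>M) = 0"
    by (rule gaussian_variable_expectation[OF _ brownian_increment_law[OF W s t]]; simp)+
  show "integrable M (\<lambda>w. Gamma_cov \<mu> \<sigma>0 \<sigma>1 (s, Z s w) (t, Z t w))"
    unfolding Gamma
    by (intro integrable_mult_right Bochner_Integration.integrable_add Bochner_Integration.integrable_diff S T D)
  have "(\<integral>w. Gamma_cov \<mu> \<sigma>0 \<sigma>1 (s, Z s w) (t, Z t w) \<partial>M)
      = \<mu> * ((\<integral>w. Psi (\<sigma>1\<^sup>2 * s) (- \<sigma>2 * W s w) \<partial>M) + (\<integral>w. Psi (\<sigma>1\<^sup>2 * t) (\<sigma>2 * W t w) \<partial>M)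
        - (\<integral>w. Psi (\<sigma>1\<^sup>2 * \<bar>s - t\<bar>) (\<sigma>2 * (W s w - W t w)) \<partial>M) - (\<integral>w. \<sigma>2 * (W s w - W t w) \<partial>M))"
    unfolding Gamma
    by (subst integral_mult_right_zero, simp only: Bochner_Integration.integral_diff Bochner_Integration.integral_add
        Bochner_Integration.integrable_add Bochner_Integration.integrable_diff S(1) T(1) D(1) D(3))
  also have "\<dots> = \<mu> * ((sqrt (\<sigma>1\<^sup>2 + \<sigma>2\<^sup>2) * sqrt s) / sqrt (2 * pi) + (sqrt (\<sigma>1\<^sup>2 + \<sigma>2\<^sup>2) * sqrt t) / sqrt (2 * pi)
        - (sqrt (\<sigma>1\<^sup>2 + \<sigma>2\<^sup>2) * sqrt \<bar>s - t\<bar>) / sqrt (2 * pi) - 0)"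
    unfolding S(2) T(2) D(2) D(4) by (simp only: power2_minus distrib_right[symmetric] real_sqrt_mult)
  also have "\<dots> = \<mu> * sqrt (\<sigma>1\<^sup>2 + \<sigma>2\<^sup>2) / sqrt (2 * pi) * (sqrt s + sqrt t - sqrt \<bar>s - t\<bar>)"
    by (simp add: add_divide_distrib diff_divide_distrib algebra_simps)
  finally show "(\<integral>w. Gamma_cov \<mu> \<sigma>0 \<sigma>1 (s, Z s w) (t, Z t w) \<partial>M)
      = \<mu> * sqrt (\<sigma>1\<^sup>2 + \<sigma>2\<^sup>2) / sqrt (2 * pi) * (sqrt s + sqrt t - sqrt \<bar>s - t\<bar>)" .
qed

text \<open>
  If \<open>V i\<close> is itself Gaussian, it is centred with variance the mean of \<open>C w i i\<close>. Computing the mean of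
  \<open>cos (V i)\<close> both directly and by conditioning then gives equality in Jensen's inequality.
\<close>

lemma conditionally_centered_gaussian_constant_variance:
  assumes "prob_space M" "subalgebra M F" "conditionally_centered_gaussian M F I V C"
    and i: "i \<in> I" and var: "integrable M (\<lambda>w. C w i i)" "AE w in M. 0 \<le> C w i i"
    and law: "0 \<le> v" "distr M borel (V i) = gaussian_law m v"
  shows "AE w in M. C w i i = (\<integral>w. C w i i \<partial>M)"
proof -
  have meas [measurable]: "V i \<in> borel_measurable M"
    using assms(3) i unfolding conditionally_centered_gaussian_def by (elim conjE) (rule bspec)
  have "m = (\<integral>w. V i w \<partial>M)"
    using gaussian_law_moments(2)[OF law(1), of m] integral_distr[OF meas, of "\<lambda>x. x"]
    unfolding law(2) by simp
  then have m: "m = 0"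
    using conditionally_centered_gaussian_mean[OF assms(1-3) i var(1)] by simp
  have "v = (\<integral>w. (V i w)\<^sup>2 \<partial>M)"
    using gaussian_law_moments(4)[OF law(1), of m] integral_distr[OF meas, of "\<lambda>x. x\<^sup>2"] m
    unfolding law(2) by simp
  also have "\<dots> = (\<integral>w. C w i i \<partial>M)"
    using conditionally_centered_gaussian_covariance(2)[OF assms(1-3) i i var(1) var(1)] var(1)
    by (simp add: power2_eq_square borel_measurable_integrable)
  finally have v: "v = (\<integral>w. C w i i \<partial>M)" .
  have "(\<integral>w. exp (- C w i i / 2) \<partial>M) = (\<integral>w. cos (V i w) \<partial>M)"
    using var(1) by (intro conditionally_centered_gaussian_cos[OF assms(1-3) i, symmetric]) simp
  also have "\<dots> = exp (- v / 2)"
    using gaussian_law_integral_cos[OF law(1)] integral_distr[OF meas, of cos] m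
    unfolding law(2) by simp
  finally show ?thesis
    unfolding v by (rule AE_eq_expectation_if_exp_Jensen_eq[OF assms(1) var])
qed

theorem corollary2p5:
  fixes P :: "(int \<Rightarrow> real) measure"
    and S :: "'b measure"
    and Q :: "(int \<Rightarrow> real) \<Rightarrow> 'b measure"
    and X :: "int \<Rightarrow> nat \<Rightarrow> nat \<Rightarrow> 'b \<Rightarrow> int"
    and \<eta> :: "int \<Rightarrow> 'b \<Rightarrow> nat"
    and M :: "'c measure"
    and W Z :: "real \<Rightarrow> 'c \<Rightarrow> real"
    and V :: "real \<times> real \<Rightarrow> 'c \<Rightarrow> real"
    and \<mu> \<sigma>0 \<sigma>1 \<sigma>2 :: real
  assumes "iid_elliptic_environment P"
    and "(\<integral>\<omega>. (rho \<omega> 0)\<^sup>2 \<partial>P) < 1"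
    and "quenched_walks S Q X"
    and "stationary_initial_configuration Q X \<eta>"
    and "initial_moment_condition P Q \<eta>"
    and "\<mu> = (\<integral>w. real (\<eta> 0 w) \<partial>(averaged_law P Q))"
    and "\<sigma>0\<^sup>2 = (\<integral>\<omega>. quenched_var Q \<omega> (\<eta> 0) \<partial>P)"
    and "\<sigma>1\<^sup>2 = speed P ^ 3 * (\<integral>\<omega>. quenched_var Q \<omega> (hitting_time_1 X) \<partial>P)"
    and "\<sigma>2\<^sup>2 = speed P ^ 2 * variance_wrt P (\<lambda>\<omega>. quenched_mean Q \<omega> (hitting_time_1 X))"
    and "\<sigma>1 > 0" and "\<sigma>2 > 0"
    and "standard_brownian_motion M W"
    and "\<And>t w. t \<ge> 0 \<Longrightarrow> Z t w = \<sigma>2 * W t w"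
    and "conditionally_centered_gaussian M (path_algebra M Z) ({0..} \<times> UNIV) V
           (\<lambda>w (s, q) (t, r). Gamma_cov \<mu> \<sigma>0 \<sigma>1 (s, q + Z s w) (t, r + Z t w))"
    and "\<mu> = \<sigma>0\<^sup>2"
  shows "(\<forall>s\<ge>0. \<forall>t\<ge>0.
            integrable M (\<lambda>w. V (s, 0) w * V (t, 0) w) \<and>
            (\<integral>w. V (s, 0) w * V (t, 0) w \<partial>M) =
              \<mu> * sqrt (\<sigma>1\<^sup>2 + \<sigma>2\<^sup>2) / sqrt (2 * pi) * (sqrt s + sqrt t - sqrt \<bar>s - t\<bar>)) \<and>
         (\<mu> > 0 \<longrightarrow> \<not> gaussian_process M {0..} (\<lambda>t. V (t, 0)))"
proof (intro conjI allI impI)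
  note W = assms(12) and Z = assms(13) and V = assms(14) and eq = assms(15)
  have M: "prob_space M" using W by (simp add: standard_brownian_motion_def)
  have Z_meas: "Z t \<in> borel_measurable M" if "0 \<le> t" for t
  proof -
    have "Z t = (\<lambda>w. \<sigma>2 * W t w)" using Z that by auto
    moreover have "W t \<in> borel_measurable M" using W that by (simp add: standard_brownian_motion_def)
    ultimately show ?thesis by simp
  qed
  have sub: "subalgebra M (path_algebra M Z)"
    using Z_meas by (rule subalgebra_path_algebra)
  have Gamma: "integrable M (\<lambda>w. Gamma_cov \<mu> \<sigma>0 \<sigma>1 (s, Z s w) (t, Z t w))"
    "(\<integral>w. Gamma_cov \<mu> \<sigma>0 \<sigma>1 (s, Z s w) (t, Z t w) \<partial>M)
      = \<mu> * sqrt (\<sigma>1\<^sup>2 + \<sigma>2\<^sup>2) / sqrt (2 * pi) * (sqrt s + sqrt t - sqrt \<bar>s - t\<bar>)"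
    if "0 \<le> s" "0 \<le> t" for s t
    by (rule Gamma_cov_brownian_expectation[OF W _ eq that], erule Z)+
  {
    fix s t :: real assume "0 \<le> s" "0 \<le> t"
    note st = this
    have I: "(s, 0) \<in> {0..} \<times> (UNIV :: real set)" "(t, 0) \<in> {0..} \<times> (UNIV :: real set)"
      using st by auto
    note cov = conditionally_centered_gaussian_covariance[OF M sub V I, unfolded prod.case add_0_left,
        OF Gamma(1)[OF st(1) st(1)] Gamma(1)[OF st(2) st(2)] borel_measurable_integrable[OF Gamma(1)[OF st]]]
    show "integrable M (\<lambda>w. V (s, 0) w * V (t, 0) w)"
      by (rule cov(1))
    have "(\<integral>w. V (s, 0) w * V (t, 0) w \<partial>M)
        = (\<integral>w. Gamma_cov \<mu> \<sigma>0 \<sigma>1 (s, Z s w) (t, Z t w) \<partial>M)"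
      by (rule cov(2))
    also have "\<dots> = \<mu> * sqrt (\<sigma>1\<^sup>2 + \<sigma>2\<^sup>2) / sqrt (2 * pi) * (sqrt s + sqrt t - sqrt \<bar>s - t\<bar>)"
      by (rule Gamma(2)[OF st])
    finally show "(\<integral>w. V (s, 0) w * V (t, 0) w \<partial>M)
        = \<mu> * sqrt (\<sigma>1\<^sup>2 + \<sigma>2\<^sup>2) / sqrt (2 * pi) * (sqrt s + sqrt t - sqrt \<bar>s - t\<bar>)" .
  }
  assume "0 < \<mu>"
  show "\<not> gaussian_process M {0..} (\<lambda>t. V (t, 0))"
  proof
    assume "gaussian_process M {0..} (\<lambda>t. V (t, 0))"
    then obtain m v where law: "0 \<le> v" "distr M borel (V (1, 0)) = gaussian_law m v"
      by (rule gaussian_process_marginal[where i = 1]) simp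
    (* Time 1 suffices: c is the conditional variance of V (1, 0). *)
    define c where "c = (\<lambda>w. Gamma_cov \<mu> \<sigma>0 \<sigma>1 (1, Z 1 w) (1, Z 1 w))"
    have c_ge: "\<mu> * \<bar>Z 1 w\<bar> \<le> c w" for w
    proof -
      have "\<bar>Z 1 w\<bar> \<le> Psi (\<sigma>1\<^sup>2) (- Z 1 w) + Psi (\<sigma>1\<^sup>2) (Z 1 w)"
        using Psi_bounds[of "\<sigma>1\<^sup>2" "Z 1 w"] Psi_bounds[of "\<sigma>1\<^sup>2" "- Z 1 w"] by auto
      also have "\<mu> * \<dots> = c w"
        unfolding c_def by (subst Gamma_cov_equal_parameters[OF eq]) (auto simp: Psi_def)
      finally show ?thesis using \<open>0 < \<mu>\<close> by simp
    qed
    have c_int: "integrable M c"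
      unfolding c_def by (rule Gamma(1)) simp_all
    have c_nonneg: "AE w in M. 0 \<le> c w"
    proof (rule AE_I2)
      fix w
      have "0 \<le> \<mu> * \<bar>Z 1 w\<bar>" using \<open>0 < \<mu>\<close> by simp
      then show "0 \<le> c w" using c_ge by (rule order_trans)
    qed
    have "(1::real, 0) \<in> {0..} \<times> (UNIV :: real set)" by simp
    note constant_var = conditionally_centered_gaussian_constant_variance[OF M sub V this _ _ law,
        unfolded prod.case add_0_left]
    have "AE w in M. c w = (\<integral>w. c w \<partial>M)"
      using c_int c_nonneg unfolding c_def by (rule constant_var)
    then have "AE w in M. \<bar>Z 1 w\<bar> \<le> (\<integral>w. c w \<partial>M) / \<mu>"
    proof eventually_elim
      case (elim w)
      then show ?case
        using c_ge[of w] \<open>0 < \<mu>\<close> by (simp add: pos_le_divide_eq mult.commute)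
    qed
    then have bounded: "AE x in distr M borel (Z 1). \<bar>x\<bar> \<le> (\<integral>w. c w \<partial>M) / \<mu>"
      by (subst AE_distr_iff) (simp_all add: Z_meas)
    have "Z 1 = (\<lambda>w. \<sigma>2 * W 1 w)" using Z by auto
    then have Z_law: "distr M borel (Z 1) = gaussian_law 0 (\<sigma>2\<^sup>2)"
      using brownian_marginal_law[OF W, of 1 \<sigma>2] by simp
    have "0 < \<sigma>2\<^sup>2" using assms(11) by simp
    from gaussian_law_not_AE_bounded[OF this] bounded show False
      unfolding Z_law by (rule notE)
  qed
qed

end
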